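(* Let $G$ be a locally compact Abelian group and let $S\subset G$ be a set whose asymptotic uniform upper density with respect to the counting measure of $S$ is positive but finite, i.e. $0<\overline{D}^{\#}(S)<\infty$. Then the difference set $S-S$ is a syndetic set in $G$.
   Context: $G$ is a locally compact (Hausdorff) Abelian group written additively, with a fixed Haar measure $\mu$. $\mathcal{B}_0$ denotes the family of all nonempty open subsets of $G$ with compact closure. For an arbitrary set $\Lambda\subset G$, $$\overline{D}^{\#}(\Lambda):=\inf_{C}\ \sup_{V\in\mathcal{B}_0}\frac{\#(\Lambda\cap V)}{\mu(C+V)}\in[0,\infty],$$ where the infimum is over all nonempty compact $C\subset G$ and $\#$ denotes cardinality ($\infty$ for infinite sets). $S-S=\{s-t:s,t\in S\}$. A set $T\subset G$ is syndetic if there is a compact $K\subset G$ with $\bigcup_{k\in K}(T-k)=G$. *)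

theory Defs
  imports "HOL-Analysis.Analysis"
begin

text \<open>
  Groups that need not be \<open>\<sigma>\<close>-compact are covered, so regularity is the usual one for Haar
  measures: outer regularity on all Borel sets, inner regularity on open sets.
\<close>

definition haar_measure :: "'a::{topological_ab_group_add, t2_space} measure \<Rightarrow> bool" where
  "haar_measure \<mu> \<longleftrightarrow>
     sets \<mu> = sets borel \<and>
     emeasure \<mu> UNIV \<noteq> 0 \<and>
     (\<forall>K. compact K \<longrightarrow> emeasure \<mu> K < \<infinity>) \<and>
     (\<forall>x. \<forall>A\<in>sets borel. emeasure \<mu> ((\<lambda>a. x + a) ` A) = emeasure \<mu> A) \<and>
     (\<forall>A\<in>sets borel. emeasure \<mu> A = (INF U\<in>{U. open U \<and> A \<subseteq> U}. emeasure \<mu> U)) \<and>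
     (\<forall>U. open U \<longrightarrow> emeasure \<mu> U = (SUP K\<in>{K. compact K \<and> K \<subseteq> U}. emeasure \<mu> K))"

text \<open>
  The sum \<open>C + V\<close> below is the Minkowski sum. It is open, hence Borel, and for a Haar measure
  \<open>\<mu>\<close> its measure is positive and finite, so the quotient is never one of the degenerate cases
  of division on \<^typ>\<open>ennreal\<close>.
\<close>

definition upper_density ::
  "'a::{topological_ab_group_add, t2_space} measure \<Rightarrow> 'a set \<Rightarrow> ennreal" where
  "upper_density \<mu> \<Lambda> =
     (INF C\<in>{C. compact C \<and> C \<noteq> {}}.
        SUP V\<in>{V. open V \<and> V \<noteq> {} \<and> compact (closure V)}.
          emeasure (count_space UNIV) (\<Lambda> \<inter> V) / emeasure \<mu> (C + V))"

text \<open>Not \<open>S - S\<close>, which in HOL is the set-theoretic difference.\<close>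

definition difference_set :: "'a::ab_group_add set \<Rightarrow> 'a set" where
  "difference_set S = {s - t | s t. s \<in> S \<and> t \<in> S}"

definition syndetic :: "'a::topological_ab_group_add set \<Rightarrow> bool" where
  "syndetic T \<longleftrightarrow> (\<exists>K. compact K \<and> (\<Union>k\<in>K. (\<lambda>t. t - k) ` T) = UNIV)"

end

theory Submission
  imports Defs
begin

text \<open>
  If \<open>S - S\<close> is not syndetic then, for a fixed relatively compact open \<open>U\<close>, there are arbitrarily
  large finite sets \<open>F\<close> whose distinct elements have differences outside \<open>(S - S) + (U - U)\<close>. The
  sets \<open>S + t + U\<close> with \<open>t \<in> F\<close> are then pairwise disjoint, so the sets \<open>s + t + U\<close> cover each
  point at most \<open>N = sup\<^sub>x #(S \<inter> (x - U))\<close> times; this is a bound independent of \<open>F\<close>, finite because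
  the density of \<open>S\<close> is. Integrating the number of covers, with \<open>s\<close> restricted to \<open>S \<inter> V\<close>, yields
  \<open>#F #(S \<inter> V) \<mu>(U) \<le> N \<mu>(F + U + V)\<close>. Hence the density of \<open>S\<close> is at most
  \<open>N / (#F \<mu>(U))\<close> for arbitrarily large \<open>#F\<close>, that is, zero.
\<close>

section \<open>Compactness and openness of Minkowski sums, translates and reflections\<close>

lemma compact_set_plus:
  fixes A B :: "'a::topological_monoid_add set"
  assumes "compact A" "compact B"
  shows "compact (A + B)"
proof -
  have "A + B = (\<lambda>p. fst p + snd p) ` (A \<times> B)"
    by (force simp: set_plus_def)
  moreover have "compact \<dots>"
    by (intro compact_continuous_image compact_Times assms continuous_intros)
  ultimately show ?thesis by simp
qed

lemma compact_uminus_image: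
  fixes A :: "'a::topological_group_add set"
  assumes "compact A"
  shows "compact (uminus ` A)"
  by (intro compact_continuous_image assms continuous_intros)

lemma compact_closure_subset_compact:
  fixes K :: "'a::t2_space set"
  assumes "compact K" "A \<subseteq> K"
  shows "compact (closure A)"
proof -
  have "closure A \<subseteq> K"
    using assms by (simp add: closure_minimal compact_imp_closed)
  then show ?thesis
    using assms(1) by (metis closed_closure compact_Int_closed inf.absorb2)
qed

lemma set_plus_nonempty:
  fixes A B :: "'a::plus set"
  assumes "A \<noteq> {}" "B \<noteq> {}"
  shows "A + B \<noteq> {}"
  using assms by (blast intro: set_plus_intro)

lemma open_translation_group:
  fixes U :: "'a::topological_ab_group_add set"
  assumes "open U"
  shows "open ((\<lambda>a. x + a) ` U)"
proof -
  have "(\<lambda>a. x + a) ` U = (\<lambda>y. y - x) -` U"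
    by (force simp: algebra_simps image_iff)
  moreover have "open \<dots>"
    by (intro open_vimage assms continuous_intros)
  ultimately show ?thesis by simp
qed

lemma open_uminus_image:
  fixes U :: "'a::topological_ab_group_add set"
  assumes "open U"
  shows "open (uminus ` U)"
proof -
  have "uminus ` U = uminus -` U"
    by (force simp: image_iff)
  moreover have "open (uminus -` U)"
    by (intro open_vimage assms continuous_intros)
  ultimately show ?thesis by simp
qed

lemma open_set_plus:
  fixes A U :: "'a::topological_ab_group_add set"
  assumes "open U"
  shows "open (A + U)"
proof -
  have "A + U = (\<Union>a\<in>A. (\<lambda>u. a + u) ` U)"
    by (force simp: set_plus_def)
  then show ?thesis
    using open_translation_group[OF assms] by (simp add: open_UN)
qed

section \<open>Clearing denominators; positivity and finiteness of Haar measure\<close>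

lemma ennreal_divide_mult_cancel:
  fixes a b :: ennreal
  assumes "b \<noteq> 0" "b \<noteq> top"
  shows "a / b * b = a"
  using assms by (metis ennreal_divide_times ennreal_times_divide ennreal_mult_divide_eq)

lemma haar_measureD:
  fixes \<mu> :: "'a::{topological_ab_group_add, t2_space} measure"
  assumes "haar_measure \<mu>"
  shows haar_measure_sets: "sets \<mu> = sets borel"
    and haar_measure_compact: "compact K \<Longrightarrow> emeasure \<mu> K < \<infinity>"
    and haar_measure_translate: "A \<in> sets borel \<Longrightarrow> emeasure \<mu> ((\<lambda>a. x + a) ` A) = emeasure \<mu> A"
  using assms unfolding haar_measure_def by simp_all

text \<open>Finitely many translates of a null nonempty open set would cover any given compact set,
  so all compact sets would be null; inner regularity would then make the whole group null.\<close>

lemma haar_measure_open_pos: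
  fixes \<mu> :: "'a::{topological_ab_group_add, t2_space} measure"
  assumes haar: "haar_measure \<mu>" and "open U" "U \<noteq> {}"
  shows "0 < emeasure \<mu> U"
proof (rule ccontr)
  assume "\<not> 0 < emeasure \<mu> U"
  then have U0: "emeasure \<mu> U = 0" by simp
  note [simp] = haar_measure_sets[OF haar]
  have null: "emeasure \<mu> K = 0" if K: "compact K" for K
  proof -
    \<comment> \<open>Translating by \<open>k - u\<close> moves \<open>u\<close> to
      \<open>k\<close>, so the translate of \<open>U\<close> attached to \<open>k\<close> contains
      \<open>k\<close>.\<close>
    obtain u where u: "u \<in> U" using assms by blast
    have "K \<subseteq> (\<Union>k\<in>K. (\<lambda>a. (k - u) + a) ` U)"
    proof
      fix k assume "k \<in> K"
      moreover have "k \<in> (\<lambda>a. (k - u) + a) ` U"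
        using u by (auto intro: image_eqI[where x = u])
      ultimately show "k \<in> (\<Union>k\<in>K. (\<lambda>a. (k - u) + a) ` U)" by blast
    qed
    then obtain D where D: "D \<subseteq> K" "finite D" "K \<subseteq> (\<Union>k\<in>D. (\<lambda>a. (k - u) + a) ` U)"
      using compactE_image[OF K, of K "\<lambda>k. (\<lambda>a. (k - u) + a) ` U"] open_translation_group[OF \<open>open U\<close>]
      by metis
    have meas: "(\<lambda>a. x + a) ` U \<in> sets \<mu>" for x
      using open_translation_group[OF \<open>open U\<close>] by simp
    have "emeasure \<mu> K \<le> emeasure \<mu> (\<Union>k\<in>D. (\<lambda>a. (k - u) + a) ` U)"
      using D meas by (intro emeasure_mono sets.finite_UN) auto
    also have "\<dots> \<le> (\<Sum>k\<in>D. emeasure \<mu> ((\<lambda>a. (k - u) + a) ` U))"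
      using D meas by (intro emeasure_subadditive_finite) auto
    also have "\<dots> = 0"
      using haar_measure_translate[OF haar, of U] U0 \<open>open U\<close> by simp
    finally show ?thesis by simp
  qed
  \<comment> \<open>\<open>UNIV\<close> is open, so inner regularity applies to it, and no covering
    by countably many compact sets is involved.\<close>
  have "emeasure \<mu> UNIV = (SUP K\<in>{K. compact K \<and> K \<subseteq> UNIV}. emeasure \<mu> K)"
    using haar open_UNIV unfolding haar_measure_def by blast
  also have "\<dots> \<le> 0"
    using null by (intro SUP_least) auto
  finally show False
    using haar unfolding haar_measure_def by auto
qed

lemma haar_measure_compact_plus_finite:
  fixes \<mu> :: "'a::{topological_ab_group_add, t2_space} measure"
  assumes haar: "haar_measure \<mu>" and "compact C" "compact (closure V)"
  shows "emeasure \<mu> (C + V) < \<infinity>"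
proof -
  have "compact (C + closure V)"
    using assms compact_set_plus by blast
  moreover have "emeasure \<mu> (C + V) \<le> emeasure \<mu> (C + closure V)"
    using haar_measure_sets[OF haar] \<open>compact (C + closure V)\<close> closure_subset[of V]
    by (intro emeasure_mono set_plus_mono2) (simp_all add: compact_imp_closed)
  ultimately show ?thesis
    using haar_measure_compact[OF haar] le_less_trans by blast
qed

section \<open>Counting bounds from finite density\<close>

text \<open>A finite infimum gives one \<open>C\<close> with a finite supremum, which bounds
  \<open>#(S \<inter> V)\<close> by a multiple of the measure of \<open>C + V\<close>. For the sets
  \<open>x - U\<close> this measure does not depend on \<open>x\<close>, by translation invariance.
  Finiteness is recorded beside the bound because \<open>card\<close> of an infinite set is
  0.\<close>

lemma finite_upper_density_imp_uniform_count_bound: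
  fixes \<mu> :: "'a::{topological_ab_group_add, t2_space} measure"
  assumes haar: "haar_measure \<mu>" and fin: "upper_density \<mu> S < \<infinity>"
    and U: "open U" "U \<noteq> {}" "compact (closure U)"
  obtains N :: nat
  where "\<And>x. finite (S \<inter> {y. x - y \<in> U})" "\<And>x. card (S \<inter> {y. x - y \<in> U}) \<le> N"
    and "\<And>V. open V \<Longrightarrow> V \<noteq> {} \<Longrightarrow> compact (closure V) \<Longrightarrow> finite (S \<inter> V)"
proof -
  obtain C where C: "compact C" "C \<noteq> {}"
    and lt: "(SUP V\<in>{V. open V \<and> V \<noteq> {} \<and> compact (closure V)}.
          emeasure (count_space UNIV) (S \<inter> V) / emeasure \<mu> (C + V)) < \<infinity>" (is "?M < _")
    using fin unfolding upper_density_def INF_less_iff by auto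
  have bound: "emeasure (count_space UNIV) (S \<inter> V) \<le> ?M * emeasure \<mu> (C + V)"
    if V: "open V" "V \<noteq> {}" "compact (closure V)" for V
  proof -
    have le: "emeasure (count_space UNIV) (S \<inter> V) / emeasure \<mu> (C + V) \<le> ?M"
      using V by (intro SUP_upper) auto
    have "emeasure \<mu> (C + V) \<noteq> 0"
      using haar_measure_open_pos[OF haar open_set_plus[OF V(1)] set_plus_nonempty[OF C(2) V(2)]]
      by simp
    moreover have "emeasure \<mu> (C + V) \<noteq> \<infinity>"
      using haar_measure_compact_plus_finite[OF haar] C V by (metis less_irrefl)
    ultimately have "emeasure (count_space UNIV) (S \<inter> V)
        = emeasure (count_space UNIV) (S \<inter> V) / emeasure \<mu> (C + V) * emeasure \<mu> (C + V)"
      by (simp add: ennreal_divide_mult_cancel)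
    also have "\<dots> \<le> ?M * emeasure \<mu> (C + V)"
      using le by (intro mult_right_mono) auto
    finally show ?thesis .
  qed
  have finV: "finite (S \<inter> V)" if V: "open V" "V \<noteq> {}" "compact (closure V)" for V
  proof -
    have "?M * emeasure \<mu> (C + V) < \<infinity>"
      using lt haar_measure_compact_plus_finite[OF haar C(1) V(3)] by (simp add: ennreal_mult_less_top)
    then have "emeasure (count_space UNIV) (S \<inter> V) < \<infinity>"
      using bound[OF V] by (rule le_less_trans[rotated])
    then show ?thesis
      by (auto simp: emeasure_count_space split: if_splits)
  qed
  \<comment> \<open>Every \<open>x - U\<close> is the translate by \<open>x\<close> of the single
    set \<open>W = -U\<close>.\<close>
  define W where "W = uminus ` U"
  have openW: "open W" using open_uminus_image U(1) unfolding W_def by blast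
  have refl: "{y. x - y \<in> U} = (\<lambda>a. x + a) ` W" for x
    unfolding W_def image_image by (force simp: image_iff algebra_simps)
  have cl: "compact (closure ((\<lambda>a. x + a) ` W))" for x
  proof -
    have "compact ((\<lambda>a. x + a) ` uminus ` closure U)"
      by (intro compact_continuous_image continuous_intros U(3))
    moreover have "(\<lambda>a. x + a) ` W \<subseteq> (\<lambda>a. x + a) ` uminus ` closure U"
      unfolding W_def using closure_subset[of U] by (intro image_mono)
    ultimately show ?thesis
      by (rule compact_closure_subset_compact)
  qed
  have refl_ok: "open {y. x - y \<in> U}" "{y. x - y \<in> U} \<noteq> {}" "compact (closure {y. x - y \<in> U})" for x
    using open_translation_group[OF openW] cl U(2) unfolding refl by (auto simp: W_def)
  define b where "b = ?M * emeasure \<mu> (C + W)"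
  \<comment> \<open>The translate by 0 is \<open>W\<close> itself, so \<open>cl\<close> at 0 says
    that \<open>W\<close> is relatively compact.\<close>
  have "emeasure \<mu> (C + W) < \<infinity>"
    using haar_measure_compact_plus_finite[OF haar C(1)] cl[of 0] by simp
  then have "b < \<infinity>"
    unfolding b_def using lt by (simp add: ennreal_mult_less_top)
  then obtain N :: nat where N: "b < of_nat N"
    using ennreal_Ex_less_of_nat by auto
  have "card (S \<inter> {y. x - y \<in> U}) \<le> N" for x
  proof -
    have "C + {y. x - y \<in> U} = (\<lambda>a. x + a) ` (C + W)"
      unfolding refl by (force simp: set_plus_def image_iff algebra_simps)
    then have "emeasure \<mu> (C + {y. x - y \<in> U}) = emeasure \<mu> (C + W)"
      using haar_measure_translate[OF haar, of "C + W"] open_set_plus[OF openW] by simp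
    then have "emeasure (count_space UNIV) (S \<inter> {y. x - y \<in> U}) \<le> b"
      using bound[OF refl_ok, of x] unfolding b_def by metis
    then have "of_nat (card (S \<inter> {y. x - y \<in> U})) \<le> b"
      using finV[OF refl_ok] by (simp add: emeasure_count_space)
    then have "of_nat (card (S \<inter> {y. x - y \<in> U})) < (of_nat N :: ennreal)"
      using N by (rule le_less_trans)
    then show ?thesis by simp
  qed
  then show thesis
    using finV[OF refl_ok] finV by (intro that)
qed

section \<open>Separated translates and the covering count\<close>

text \<open>Points are added one at a time: those in conflict with the finite set \<open>F\<close>
  form \<open>(S - S) + F + (K - K)\<close>, a union of translates of \<open>S - S\<close> over a
  compact set, which cannot be the whole group. Separation is required for a compact
  \<open>K\<close> so that this index set is compact.\<close>

lemma not_syndetic_imp_separated_set: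
  fixes S :: "'a::topological_ab_group_add set"
  assumes "\<not> syndetic (difference_set S)" and K: "compact K"
    and ne: "S \<noteq> {}" "K \<noteq> {}"
  shows "\<exists>F. finite F \<and> card F = n \<and>
    (\<forall>t\<in>F. \<forall>t'\<in>F. t \<noteq> t' \<longrightarrow>
      (\<forall>s\<in>S. \<forall>s'\<in>S. \<forall>u\<in>K. \<forall>u'\<in>K. s + t + u \<noteq> s' + t' + u'))"
proof (induction n)
  case 0
  show ?case by (intro exI[of _ "{}"]) auto
next
  case (Suc n)
  then obtain F where F: "finite F" "card F = n"
    and sep: "\<And>t t' s s' u u'. \<lbrakk>t \<in> F; t' \<in> F; t \<noteq> t'; s \<in> S; s' \<in> S; u \<in> K; u' \<in> K\<rbrakk>
      \<Longrightarrow> s + t + u \<noteq> s' + t' + u'"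
    by blast
  \<comment> \<open>A collision \<open>s + x + u = s' + t + u'\<close> means
    \<open>x = (s' - s) - k\<close> with \<open>k = -t + (u - u')\<close>; \<open>L\<close> collects
    these \<open>k\<close>.\<close>
  define L where "L = uminus ` F + (K + uminus ` K)"
  have "compact L"
    unfolding L_def using K finite_imp_compact[OF F(1)] by (intro compact_set_plus compact_uminus_image)
  then obtain x where x: "x \<notin> (\<Union>k\<in>L. (\<lambda>t. t - k) ` difference_set S)"
    using assms unfolding syndetic_def by blast
  have new: "s + x + u \<noteq> s' + t + u'"
    if "t \<in> F" "s \<in> S" "s' \<in> S" "u \<in> K" "u' \<in> K" for s s' t u u'
  proof
    assume eq: "s + x + u = s' + t + u'"
    have "x + s + u = t + s' + u'"
      using eq by (simp add: ac_simps)
    then have "x = t + s' + u' - u - s"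
      by (simp add: eq_diff_eq ac_simps)
    then have "x = (s' - s) - (- t + (u + - u'))"
      by (simp add: algebra_simps)
    moreover have "- t + (u + - u') \<in> L"
      unfolding L_def using that by (intro set_plus_intro) auto
    moreover have "s' - s \<in> difference_set S"
      unfolding difference_set_def using that by blast
    ultimately show False using x by blast
  qed
  \<comment> \<open>If \<open>x\<close> were in \<open>F\<close>, taking \<open>t = x\<close>,
    \<open>s = s'\<close> and \<open>u = u'\<close> in \<open>new\<close> would be absurd; this
    needs points of \<open>S\<close> and \<open>K\<close>.\<close>
  have "x \<notin> F" using new ne by fastforce
  then have "finite (insert x F)" "card (insert x F) = Suc n" using F by auto
  \<comment> \<open>Either both points are old, or one is \<open>x\<close>; when \<open>t'\<close>
    is \<open>x\<close>, \<open>new\<close> is used with primed and unprimed elements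
    exchanged.\<close>
  moreover have "s + t + u \<noteq> s' + t' + u'"
    if "t \<in> insert x F" "t' \<in> insert x F" "t \<noteq> t'" "s \<in> S" "s' \<in> S" "u \<in> K" "u' \<in> K"
    for s s' t t' u u'
    using that(1,2,3) sep[OF _ _ _ that(4-7), of t t'] new[OF _ that(4-7), of t']
      new[OF _ that(5,4,7,6), of t] by (elim insertE) simp_all
  ultimately show ?case
    by (intro exI[of _ "insert x F"] conjI ballI impI)
qed

text \<open>The translates \<open>s + t + U\<close> are counted with multiplicity. At a covered
  point separation determines \<open>t\<close>, and then \<open>s\<close> lies in
  \<open>S \<inter> (x - t - U)\<close>, which leaves at most \<open>N\<close> pairs.\<close>

lemma separated_count_le:
  fixes \<mu> :: "'a::{topological_ab_group_add, t2_space} measure"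
  assumes haar: "haar_measure \<mu>" and "open U" and "open V"
    and finV: "finite (S \<inter> V)" and "finite F"
    and fin: "\<And>x. finite (S \<inter> {y. x - y \<in> U})" and N: "\<And>x. card (S \<inter> {y. x - y \<in> U}) \<le> N"
    and sep: "\<And>t t' s s' u u'. \<lbrakk>t \<in> F; t' \<in> F; t \<noteq> t'; s \<in> S; s' \<in> S; u \<in> U; u' \<in> U\<rbrakk>
      \<Longrightarrow> s + t + u \<noteq> s' + t' + u'"
  shows "of_nat (card F) * of_nat (card (S \<inter> V)) * emeasure \<mu> U \<le> of_nat N * emeasure \<mu> (F + U + V)"
proof -
  define P where "P = (S \<inter> V) \<times> F"
  define A where "A p = (\<lambda>u. (fst p + snd p) + u) ` U" for p
  have finP: "finite P" unfolding P_def using assms by blast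
  have A_sets [measurable]: "A p \<in> sets \<mu>" for p
    unfolding A_def using open_translation_group[OF \<open>open U\<close>] haar_measure_sets[OF haar] by auto
  have FUV_sets [measurable]: "F + U + V \<in> sets \<mu>"
    using open_set_plus[OF \<open>open V\<close>] haar_measure_sets[OF haar] by auto
  have pointwise: "(\<Sum>p\<in>P. indicator (A p) x) \<le> of_nat N * (indicator (F + U + V) x :: ennreal)" for x
  proof -
    define Q where "Q = {p\<in>P. x \<in> A p}"
    have sum: "(\<Sum>p\<in>P. indicator (A p) x) = (of_nat (card Q) :: ennreal)"
      using finP unfolding Q_def indicator_def by (simp add: sum.If_cases Int_def)
    show ?thesis
    proof (cases "Q = {}")
      case True
      then show ?thesis unfolding sum by simp
    next
      case False
      then obtain s t u where p: "s \<in> S" "s \<in> V" "t \<in> F" "u \<in> U" "x = s + t + u"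
        unfolding Q_def P_def A_def by auto
      \<comment> \<open>Commutativity puts \<open>s\<close>, a point of \<open>V\<close>, last:
        every covered point lies in \<open>F + U + V\<close>.\<close>
      have "x = t + u + s" using p by (simp add: ac_simps)
      then have xin: "x \<in> F + U + V" using p(2-4) by (simp add: set_plus_intro)
      \<comment> \<open>All pairs covering \<open>x\<close> share the second component
        \<open>t\<close>, so they embed into one fibre.\<close>
      have "Q \<subseteq> (\<lambda>s. (s, t)) ` (S \<inter> {y. (x - t) - y \<in> U})"
      proof
        fix q assume q: "q \<in> Q"
        then obtain s' t' u' where q': "q = (s', t')" "s' \<in> S" "t' \<in> F" "u' \<in> U" "x = s' + t' + u'"
          unfolding Q_def P_def A_def by auto
        have "t' = t"
          using sep[OF \<open>t' \<in> F\<close> \<open>t \<in> F\<close> _ \<open>s' \<in> S\<close> \<open>s \<in> S\<close> \<open>u' \<in> U\<close> \<open>u \<in> U\<close>] p(5) q'(5) by metis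
        moreover have "x - t' - s' = u'" using q'(5) by (simp add: algebra_simps)
        ultimately show "q \<in> (\<lambda>s. (s, t)) ` (S \<inter> {y. (x - t) - y \<in> U})"
          using q' by auto
      qed
      then have "card Q \<le> card (S \<inter> {y. (x - t) - y \<in> U})"
        using fin by (rule surj_card_le[rotated])
      also have "\<dots> \<le> N" by (rule N)
      finally show ?thesis unfolding sum using xin by simp
    qed
  qed
  have "of_nat (card F) * of_nat (card (S \<inter> V)) * emeasure \<mu> U = (\<Sum>p\<in>P. emeasure \<mu> (A p))"
    unfolding A_def using haar_measure_translate[OF haar, of U] \<open>open U\<close>
    by (simp add: P_def card_cartesian_product mult.commute)
  also have "\<dots> = (\<integral>\<^sup>+x. (\<Sum>p\<in>P. indicator (A p) x) \<partial>\<mu>)"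
    by (subst nn_integral_sum) auto
  also have "\<dots> \<le> (\<integral>\<^sup>+x. of_nat N * indicator (F + U + V) x \<partial>\<mu>)"
    by (intro nn_integral_mono pointwise)
  also have "\<dots> = of_nat N * emeasure \<mu> (F + U + V)"
    by (subst nn_integral_cmult_indicator) auto
  finally show ?thesis .
qed

section \<open>Vanishing of the density and the contradiction\<close>

theorem theorem5:
  fixes \<mu> :: "'a::{topological_ab_group_add, t2_space} measure"
    and S :: "'a set"
  assumes "locally_compact_space (euclidean :: 'a topology)"
    and "haar_measure \<mu>"
    and "0 < upper_density \<mu> S"
    and "upper_density \<mu> S < \<infinity>"
  shows "syndetic (difference_set S)"
proof (rule ccontr)
  assume not_synd: "\<not> syndetic (difference_set S)"
  note haar = assms(2)
  \<comment> \<open>Local compactness at 0: \<open>K\<close> serves for separation, the open set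
    \<open>U\<close> inside it for measuring.\<close>
  obtain U K :: "'a set" where UK: "open U" "compact K" "0 \<in> U" "U \<subseteq> K"
    using assms(1) unfolding locally_compact_space_def by (simp, meson)
  have clU: "compact (closure U)"
    using compact_closure_subset_compact[OF UK(2,4)] .
  have S_ne: "S \<noteq> {}"
  proof
    assume "S = {}"
    then have "upper_density \<mu> S \<le> 0"
      unfolding upper_density_def by (intro INF_lower2[of "{0}"] SUP_least) auto
    then show False using assms(3) by simp
  qed
  have U_ne: "U \<noteq> {}" and K_ne: "K \<noteq> {}" using UK by blast+
  obtain N where fin: "\<And>x. finite (S \<inter> {y. x - y \<in> U})"
    and N: "\<And>x. card (S \<inter> {y. x - y \<in> U}) \<le> N"
    and finV: "\<And>V. open V \<Longrightarrow> V \<noteq> {} \<Longrightarrow> compact (closure V) \<Longrightarrow> finite (S \<inter> V)"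
    using finite_upper_density_imp_uniform_count_bound[OF haar assms(4) UK(1) U_ne clU] by metis
  let ?m = "emeasure \<mu> U"
  have "0 < ?m"
    using haar_measure_open_pos[OF haar UK(1) U_ne] .
  \<comment> \<open>The compact set \<open>{0}\<close> reduces finiteness of the measure of
    \<open>U\<close> to that of a Minkowski sum.\<close>
  have "emeasure \<mu> ({0} + U) < \<infinity>"
    using haar_measure_compact_plus_finite[OF haar _ clU, of "{0}"] by simp
  then have "?m < \<infinity>" by (simp add: set_plus_def)
  \<comment> \<open>\<open>N\<close> was fixed before \<open>n\<close>, so letting \<open>n\<close>
    grow will contradict positive density. Positivity of \<open>n\<close> makes \<open>F\<close>
    nonempty and the divisor \<open>n * ?m\<close> nonzero.\<close>
  have key: "of_nat n * (upper_density \<mu> S * ?m) \<le> of_nat N" if "n > 0" for n :: nat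
  proof -
    obtain F where F: "finite F" "card F = n"
      and sep: "\<And>t t' s s' u u'. \<lbrakk>t \<in> F; t' \<in> F; t \<noteq> t'; s \<in> S; s' \<in> S; u \<in> K; u' \<in> K\<rbrakk>
        \<Longrightarrow> s + t + u \<noteq> s' + t' + u'"
      using not_syndetic_imp_separated_set[OF not_synd UK(2) S_ne K_ne, of n] by metis
    have "F \<noteq> {}" using F that by auto
    \<comment> \<open>\<open>C\<close> is the test set for the infimum; \<open>C + V\<close>
      contains \<open>F + U + V\<close> because \<open>U\<close> lies in \<open>K\<close>.\<close>
    define C where "C = F + K"
    have C: "compact C" "C \<noteq> {}"
      unfolding C_def using compact_set_plus[OF finite_imp_compact[OF F(1)] UK(2)]
        set_plus_nonempty[OF \<open>F \<noteq> {}\<close> K_ne] by simp_all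
    have "emeasure (count_space UNIV) (S \<inter> V) / emeasure \<mu> (C + V) \<le> of_nat N / (of_nat n * ?m)"
      if V: "open V" "V \<noteq> {}" "compact (closure V)" for V
    proof -
      let ?c = "of_nat (card (S \<inter> V)) :: ennreal"
      have "of_nat n * ?c * ?m \<le> of_nat N * emeasure \<mu> (F + U + V)"
        using separated_count_le[OF haar UK(1) V(1) finV[OF V] F(1) fin N
            sep[OF _ _ _ _ _ subsetD[OF UK(4)] subsetD[OF UK(4)]]]
        by (simp add: F(2))
      also have "\<dots> \<le> of_nat N * emeasure \<mu> (C + V)"
        using haar_measure_sets[OF haar] open_set_plus[OF V(1)] UK(4) unfolding C_def
        by (intro mult_left_mono emeasure_mono set_plus_mono2) auto
      finally have *: "?c * (of_nat n * ?m) \<le> of_nat N * emeasure \<mu> (C + V)"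
        by (simp add: mult_ac)
      have nm: "of_nat n * ?m \<noteq> 0" "of_nat n * ?m < top"
        using \<open>n > 0\<close> \<open>0 < ?m\<close> \<open>?m < \<infinity>\<close> by (auto simp: ennreal_mult_less_top of_nat_less_top)
      have "0 < emeasure \<mu> (C + V)"
        using haar_measure_open_pos[OF haar open_set_plus[OF V(1)] set_plus_nonempty[OF C(2) V(2)]] .
      moreover have "emeasure \<mu> (C + V) < top"
        using haar_measure_compact_plus_finite[OF haar C(1) V(3)] by simp
      moreover have "?c \<le> of_nat N * emeasure \<mu> (C + V) / (of_nat n * ?m)"
        using * nm by (metis ennreal_mult_divide_eq divide_right_mono_ennreal less_irrefl)
      ultimately have "?c / emeasure \<mu> (C + V) \<le> of_nat N / (of_nat n * ?m)"
        by (subst divide_le_posI_ennreal) (auto simp: ennreal_times_divide mult.commute)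
      then show ?thesis
        using finV[OF V] by (simp add: emeasure_count_space)
    qed
    then have "(SUP V\<in>{V. open V \<and> V \<noteq> {} \<and> compact (closure V)}.
        emeasure (count_space UNIV) (S \<inter> V) / emeasure \<mu> (C + V)) \<le> of_nat N / (of_nat n * ?m)"
      by (intro SUP_least) auto
    then have "upper_density \<mu> S \<le> of_nat N / (of_nat n * ?m)"
      unfolding upper_density_def using C by (intro INF_lower2[of C]) auto
    then have "upper_density \<mu> S * (of_nat n * ?m) \<le> of_nat N / (of_nat n * ?m) * (of_nat n * ?m)"
      by (intro mult_right_mono) auto
    also have "\<dots> = of_nat N"
      using \<open>n > 0\<close> \<open>0 < ?m\<close> \<open>?m < \<infinity>\<close>
      by (intro ennreal_divide_mult_cancel) (auto simp: ennreal_mult_eq_top_iff)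
    finally show ?thesis by (simp add: mult_ac)
  qed
  let ?d = "upper_density \<mu> S * ?m"
  have d: "?d \<noteq> 0" "?d < top"
    using assms(3,4) \<open>0 < ?m\<close> \<open>?m < \<infinity>\<close> by (auto simp: ennreal_mult_less_top)
  \<comment> \<open>\<open>?d\<close> is positive, so some natural number exceeds the finite
    quotient \<open>N / ?d\<close>, against \<open>key\<close>.\<close>
  have "of_nat N / ?d < top"
    using d(1) by (simp add: ennreal_divide_eq_top_iff less_top[symmetric])
  then obtain n :: nat where n: "of_nat N / ?d < of_nat n"
    using ennreal_Ex_less_of_nat by blast
  then have "n > 0" by (cases n) auto
  have "of_nat n \<le> of_nat N / ?d"
    using key[OF \<open>n > 0\<close>] d by (metis ennreal_mult_divide_eq divide_right_mono_ennreal less_irrefl)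
  then show False using n by simp
qed

end
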